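(* For every $\varepsilon>0$ there exists $N$ such that for all $n\ge N$, every vector trifferent code $\mathcal C\subseteq (S^2)^n$ of block length $n$ satisfies \[ |\mathcal C|\le (\sqrt2+\varepsilon)\left(\tfrac32\right)^n . \] That is, $|\mathcal C|\le(\sqrt2+o(1))(3/2)^n$ as $n\to\infty$.
   Context: $S^2=\{v\in\mathbb R^3:\|v\|=1\}$. Three points $x,y,z\in(S^2)^n$ (with coordinates $x_i,y_i,z_i\in S^2$) are vector trifferent if there is an index $i\in\{1,\dots,n\}$ such that $x_i,y_i,z_i$ are mutually orthogonal. A vector trifferent code of block length $n$ is a subset $\mathcal C\subseteq(S^2)^n$ such that any three distinct codewords $x,y,z\in\mathcal C$ are vector trifferent. *)

theory Defs
  imports "HOL-Analysis.Analysis"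
begin

text \<open>Words of block length n over the unit sphere S^2 in R^3: functions from nat
  to real^3 whose coordinates 0..n-1 lie on the unit sphere, and which are 0 outside
  (so that each element of (S^2)^n has a unique representative).\<close>
definition sphere_words :: "nat \<Rightarrow> (nat \<Rightarrow> real^3) set" where
  "sphere_words n = {x. (\<forall>i<n. norm (x i) = 1) \<and> (\<forall>i\<ge>n. x i = 0)}"

definition vector_trifferent :: "nat \<Rightarrow> (nat \<Rightarrow> real^3) \<Rightarrow> (nat \<Rightarrow> real^3) \<Rightarrow> (nat \<Rightarrow> real^3) \<Rightarrow> bool" where
  "vector_trifferent n x y z \<longleftrightarrow>
     (\<exists>i<n. x i \<bullet> y i = 0 \<and> y i \<bullet> z i = 0 \<and> x i \<bullet> z i = 0)"

definition vector_trifferent_code :: "nat \<Rightarrow> (nat \<Rightarrow> real^3) set \<Rightarrow> bool" where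
  "vector_trifferent_code n C \<longleftrightarrow> C \<subseteq> sphere_words n \<and>
     (\<forall>x\<in>C. \<forall>y\<in>C. \<forall>z\<in>C. x \<noteq> y \<and> y \<noteq> z \<and> x \<noteq> z \<longrightarrow> vector_trifferent n x y z)"

end

theory Submission
  imports Defs "HOL-Real_Asymp.Real_Asymp"
begin

text \<open>Attach to a codeword x the projection Q x, the tensor product of the projections onto the planes
  orthogonal to the x i. If u, v, w are orthonormal then the three projections onto their orthogonal
  planes multiply to 0, so Q x Q y Q z = 0 for distinct codewords. Hence in the square of
  N = (sum over x \<noteq> y of Q x Q y) almost all products vanish, which gives tr (N N*) \<le> 2 tr N, and
  Cauchy-Schwarz in dimension 3^n yields tr N \<le> 2 * 3^n, where
  tr (Q x Q y) is the product of the 1 + (x i \<bullet> y i)^2.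

  Write 1 + (x i \<bullet> y i)^2 = 4/3 + k. Since k is a positive semidefinite kernel, so are its products over
  sets S of coordinates, and summing over all pairs (x, y) gives at least |C|^2 (4/3)^n; but the pairs
  x = y contribute |C| 2^n, which has the same order as the bound. To suppress them,
  weight the set S by (1 + cos(3 pi |S| / n)) / 2 \<ge> 0, i.e. average the product of the 4/3 + k with the
  real part of the product of the 4/3 + exp(3 pi i / n) k. This has weight 1 at S = {}, changes the terms
  with x \<noteq> y by a factor of at most 1 + o(1), and on the diagonal gives o(2^n), because
  (2/3 + exp(3 pi i / n) / 3)^n tends to exp(pi i) = -1. With m = |C| (2/3)^n this
  leaves m^2 \<le> o(1) m + 2 + o(1).\<close>

section \<open>Positive semidefinite kernels\<close>

text \<open>Schur product argument: expanding over choice functions \<open>f\<close> gives tensor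
  product features, and the double sum becomes a sum of squares.\<close>

lemma gram_prod_sum_nonneg:
  fixes F :: "'a \<Rightarrow> 'b \<Rightarrow> 'c \<Rightarrow> real"
  assumes "finite S" "finite P"
  shows "0 \<le> (\<Sum>x\<in>C. \<Sum>y\<in>C. \<Prod>i\<in>S. \<Sum>p\<in>P. F x i p * F y i p)"
proof -
  have "(\<Sum>x\<in>C. \<Sum>y\<in>C. \<Prod>i\<in>S. \<Sum>p\<in>P. F x i p * F y i p)
      = (\<Sum>x\<in>C. \<Sum>y\<in>C. \<Sum>f\<in>S \<rightarrow>\<^sub>E P. (\<Prod>i\<in>S. F x i (f i)) * (\<Prod>i\<in>S. F y i (f i)))"
    using assms by (simp add: prod_sum_PiE prod.distrib)
  also have "\<dots> = (\<Sum>x\<in>C. \<Sum>f\<in>S \<rightarrow>\<^sub>E P. \<Sum>y\<in>C. (\<Prod>i\<in>S. F x i (f i)) * (\<Prod>i\<in>S. F y i (f i)))"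
    by (intro sum.cong refl sum.swap)
  also have "\<dots> = (\<Sum>f\<in>S \<rightarrow>\<^sub>E P. (\<Sum>x\<in>C. \<Prod>i\<in>S. F x i (f i)) * (\<Sum>y\<in>C. \<Prod>i\<in>S. F y i (f i)))"
    by (subst sum.swap) (simp add: sum_product)
  also have "\<dots> \<ge> 0"
    by (intro sum_nonneg) simp
  finally show ?thesis .
qed

text \<open>The features of \<open>u\<close> are the entries of the traceless matrix
  \<open>u u^T - I/3\<close>; the right side is the Frobenius inner product of two such
  matrices.\<close>

lemma inner_sq_minus_third_eq_gram:
  fixes u v :: "real^3"
  assumes "norm u = 1" "norm v = 1"
  shows "(u \<bullet> v)\<^sup>2 - 1/3 =
    (\<Sum>(a, b)\<in>UNIV. (u $ a * u $ b - (if a = b then 1/3 else 0)) * (v $ a * v $ b - (if a = b then 1/3 else 0)))"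
proof -
  have u: "u$1 * u$1 = 1 - u$2 * u$2 - u$3 * u$3" and v: "v$1 * v$1 = 1 - v$2 * v$2 - v$3 * v$3"
    using assms by (auto simp: norm_eq_1 inner_vec_def sum_3)
  have "(\<Sum>(a, b)\<in>UNIV. (u $ a * u $ b - (if a = b then 1/3 else 0)) * (v $ a * v $ b - (if a = b then 1/3 else 0)))
    = (\<Sum>a\<in>UNIV. \<Sum>b\<in>UNIV. (u $ a * u $ b - (if a = b then 1/3 else 0)) * (v $ a * v $ b - (if a = b then 1/3 else 0)))"
    by (simp add: sum.cartesian_product)
  also have "\<dots> = (u \<bullet> v)\<^sup>2 - (u \<bullet> u) / 3 - (v \<bullet> v) / 3 + 1/3"
    by (simp add: sum_3 inner_vec_def power2_eq_square field_simps)
  also have "\<dots> = (u \<bullet> v)\<^sup>2 - 1/3"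
    using assms by (simp add: norm_eq_1)
  finally show ?thesis by simp
qed

section \<open>Traces of tensor products and orthogonal projections\<close>

lemma trace_mult_transpose: "trace (A ** transpose B) = (\<Sum>a\<in>UNIV. \<Sum>b\<in>UNIV. A $ a $ b * B $ a $ b)"
  for A B :: "real^'n^'n"
  by (simp add: trace_def matrix_matrix_mult_def transpose_def)

text \<open>Let \<open>M\<close> be the sum over \<open>p\<close> of the Kronecker products of the
  matrices \<open>A p i\<close>, with rows and columns indexed by the tuples in \<open>D\<close>.
  The left side is its squared trace, the double sum its squared Frobenius norm. Cauchy-Schwarz on
  the diagonal costs the dimension \<open>card D\<close>; the off-diagonal squares only add.\<close>

lemma tensor_trace_square_le:
  fixes A :: "'a \<Rightarrow> nat \<Rightarrow> real^'n^'n"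
  shows "(\<Sum>p\<in>I. \<Prod>i<n. trace (A p i))\<^sup>2
    \<le> real CARD('n) ^ n * (\<Sum>p\<in>I. \<Sum>q\<in>I. \<Prod>i<n. trace (A p i ** transpose (A q i)))"
proof -
  define D where "D = ({..<n} \<rightarrow>\<^sub>E (UNIV :: 'n set))"
  define M where "M f g = (\<Sum>p\<in>I. \<Prod>i<n. A p i $ f i $ g i)" for f g :: "nat \<Rightarrow> 'n"
  have D: "finite D" "real (card D) = real CARD('n) ^ n"
    by (auto simp: D_def card_PiE intro: finite_PiE)
  have tr: "(\<Sum>p\<in>I. \<Prod>i<n. trace (A p i)) = (\<Sum>f\<in>D. M f f)"
  proof -
    have "(\<Sum>p\<in>I. \<Prod>i<n. trace (A p i)) = (\<Sum>p\<in>I. \<Sum>f\<in>D. \<Prod>i<n. A p i $ f i $ f i)"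
      by (simp add: trace_def prod_sum_PiE D_def)
    also have "\<dots> = (\<Sum>f\<in>D. M f f)"
      unfolding M_def by (rule sum.swap)
    finally show ?thesis .
  qed
  have fro: "(\<Prod>i<n. trace (A p i ** transpose (A q i)))
      = (\<Sum>f\<in>D. \<Sum>g\<in>D. (\<Prod>i<n. A p i $ f i $ g i) * (\<Prod>i<n. A q i $ f i $ g i))" for p q
    by (simp add: trace_mult_transpose prod_sum_PiE D_def prod.distrib)
  have "(\<Sum>p\<in>I. \<Sum>q\<in>I. \<Prod>i<n. trace (A p i ** transpose (A q i)))
      = (\<Sum>p\<in>I. \<Sum>f\<in>D. \<Sum>q\<in>I. \<Sum>g\<in>D. (\<Prod>i<n. A p i $ f i $ g i) * (\<Prod>i<n. A q i $ f i $ g i))"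
    unfolding fro by (intro sum.cong refl sum.swap)
  also have "\<dots> = (\<Sum>f\<in>D. \<Sum>p\<in>I. \<Sum>q\<in>I. \<Sum>g\<in>D. (\<Prod>i<n. A p i $ f i $ g i) * (\<Prod>i<n. A q i $ f i $ g i))"
    by (rule sum.swap)
  also have "\<dots> = (\<Sum>f\<in>D. \<Sum>p\<in>I. \<Sum>g\<in>D. \<Sum>q\<in>I. (\<Prod>i<n. A p i $ f i $ g i) * (\<Prod>i<n. A q i $ f i $ g i))"
    by (intro sum.cong refl sum.swap)
  also have "\<dots> = (\<Sum>f\<in>D. \<Sum>g\<in>D. \<Sum>p\<in>I. \<Sum>q\<in>I. (\<Prod>i<n. A p i $ f i $ g i) * (\<Prod>i<n. A q i $ f i $ g i))"
    by (intro sum.cong refl sum.swap)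
  also have "\<dots> = (\<Sum>f\<in>D. \<Sum>g\<in>D. (M f g)\<^sup>2)"
    by (simp add: M_def power2_eq_square sum_product)
  finally have sq: "(\<Sum>p\<in>I. \<Sum>q\<in>I. \<Prod>i<n. trace (A p i ** transpose (A q i))) = (\<Sum>f\<in>D. \<Sum>g\<in>D. (M f g)\<^sup>2)" .
  have "(\<Sum>f\<in>D. M f f)\<^sup>2 \<le> real (card D) * (\<Sum>f\<in>D. (M f f)\<^sup>2)"
    using sum_squared_le_sum_of_squares[of "\<lambda>f. M f f" D] by (simp add: mult.commute)
  also have "\<dots> \<le> real (card D) * (\<Sum>f\<in>D. \<Sum>g\<in>D. (M f g)\<^sup>2)"
  proof (intro mult_left_mono sum_mono)
    fix f assume "f \<in> D"
    then show "(M f f)\<^sup>2 \<le> (\<Sum>g\<in>D. (M f g)\<^sup>2)"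
      using D(1) by (intro member_le_sum) auto
  qed simp
  finally show ?thesis unfolding tr sq D(2) .
qed

definition orth_proj :: "real^'n \<Rightarrow> real^'n^'n" where
  "orth_proj u = mat 1 - (\<chi> a b. u $ a * u $ b)"

lemma orth_proj_mult_vec: "orth_proj u *v w = w - (u \<bullet> w) *\<^sub>R u"
proof -
  have "(\<chi> a b. u $ a * u $ b) *v w = (u \<bullet> w) *\<^sub>R u"
    by (simp add: vec_eq_iff matrix_vector_mult_def inner_vec_def sum_distrib_left mult_ac)
  then show ?thesis
    by (simp add: orth_proj_def matrix_vector_mult_diff_rdistrib)
qed

lemma transpose_orth_proj [simp]: "transpose (orth_proj u) = orth_proj u"
  by (simp add: orth_proj_def transpose_def vec_eq_iff mat_def mult.commute)

lemma orth_proj_idem: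
  assumes "norm u = 1"
  shows "orth_proj u ** orth_proj u = orth_proj u"
  using assms
  by (simp add: matrix_eq matrix_vector_mul_assoc[symmetric] orth_proj_mult_vec inner_diff_right norm_eq_1)

lemma trace_orth_proj_mult:
  fixes u v :: "real^3"
  assumes "norm u = 1" "norm v = 1"
  shows "trace (orth_proj u ** orth_proj v) = 1 + (u \<bullet> v)\<^sup>2"
proof -
  have "trace (orth_proj u ** orth_proj v) = 3 - u \<bullet> u - v \<bullet> v + (u \<bullet> v)\<^sup>2"
    by (simp add: orth_proj_def trace_def matrix_matrix_mult_def sum_3 inner_vec_def mat_def
        power2_eq_square algebra_simps)
  then show ?thesis using assms by (simp add: norm_eq_1)
qed

text \<open>Each entry is paired with its transposed entry by the arithmetic-geometric mean
  inequality. This handles the pair \<open>(y, x)\<close> against \<open>(x, y)\<close>, where the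
  product is the square of one matrix.\<close>

lemma abs_trace_square_le:
  fixes B :: "real^'n^'n"
  shows "\<bar>trace (B ** B)\<bar> \<le> trace (B ** transpose B)"
proof -
  have sw: "(\<Sum>a\<in>UNIV. \<Sum>b\<in>UNIV. B $ b $ a * B $ b $ a) = trace (B ** transpose B)"
    unfolding trace_mult_transpose by (rule sum.swap)
  have tr: "trace (B ** B) = (\<Sum>a\<in>UNIV. \<Sum>b\<in>UNIV. B $ a $ b * B $ b $ a)"
    by (simp add: trace_def matrix_matrix_mult_def)
  have "2 * \<bar>trace (B ** B)\<bar> \<le> (\<Sum>a\<in>UNIV. \<Sum>b\<in>UNIV. 2 * \<bar>B $ a $ b * B $ b $ a\<bar>)"
    unfolding tr sum_distrib_left[symmetric] by (intro mult_left_mono order_trans[OF sum_abs] sum_mono) auto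
  also have "\<dots> \<le> (\<Sum>a\<in>UNIV. \<Sum>b\<in>UNIV. B $ a $ b * B $ a $ b + B $ b $ a * B $ b $ a)"
  proof (intro sum_mono)
    fix a b
    show "2 * \<bar>B $ a $ b * B $ b $ a\<bar> \<le> B $ a $ b * B $ a $ b + B $ b $ a * B $ b $ a"
      using sum_squares_bound[of "\<bar>B $ a $ b\<bar>" "\<bar>B $ b $ a\<bar>"] by (simp add: abs_mult power2_eq_square)
  qed
  also have "\<dots> = 2 * trace (B ** transpose B)"
    by (simp add: sum.distrib sw) (simp add: trace_mult_transpose)
  finally show ?thesis by simp
qed

text \<open>The three projections remove from a vector its components along \<open>w\<close>,
  \<open>v\<close> and \<open>u\<close> in turn, and these make up the whole vector.\<close>

lemma orth_proj_mult3_eq_0: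
  fixes u v w :: "real^3"
  assumes "norm u = 1" "norm v = 1" "norm w = 1" "u \<bullet> v = 0" "v \<bullet> w = 0" "u \<bullet> w = 0"
  shows "orth_proj u ** orth_proj v ** orth_proj w = 0"
proof -
  define M :: "real^3^3" where "M = vector [u, v, w]"
  have "M ** transpose M = mat 1"
    using assms by (simp add: vec_eq_iff forall_3 M_def matrix_matrix_mult_def transpose_def mat_def norm_eq_1
       inner_vec_def sum_3 mult_ac)
  \<comment> \<open>Orthonormality of the rows is a right inverse; for a square matrix it is also a
    left inverse, which is the completeness of the basis used in \<open>*\<close>.\<close>
  then have "transpose M ** M = mat 1"
    using matrix_left_right_inverse by blast
  have *: "(u \<bullet> p) *\<^sub>R u + (v \<bullet> p) *\<^sub>R v + (w \<bullet> p) *\<^sub>R w = p" for p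
  proof -
    have "(u \<bullet> p) *\<^sub>R u + (v \<bullet> p) *\<^sub>R v + (w \<bullet> p) *\<^sub>R w = transpose M *v (M *v p)"
      by (simp add: M_def vec_eq_iff forall_3 inner_vec_def matrix_vector_mult_def transpose_def sum_3 mult_ac)
    also have "\<dots> = p"
      using \<open>transpose M ** M = mat 1\<close> by (simp add: matrix_vector_mul_assoc)
    finally show ?thesis .
  qed
  have "orth_proj u *v (orth_proj v *v (orth_proj w *v p)) = 0" for p
  proof -
    have "orth_proj u *v (orth_proj v *v (orth_proj w *v p))
      = p - ((u \<bullet> p) *\<^sub>R u + (v \<bullet> p) *\<^sub>R v + (w \<bullet> p) *\<^sub>R w)"
      using assms by (simp add: orth_proj_mult_vec inner_diff_right algebra_simps)
    then show ?thesis by (simp only: *) simp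
  qed
  then show ?thesis
    by (simp add: matrix_eq matrix_vector_mul_assoc[symmetric])
qed

section \<open>Upper bound for the overlaps of distinct codewords\<close>

lemma sum_cross_overlap_le:
  assumes C: "vector_trifferent_code n C" and fin: "finite C"
  shows "(\<Sum>x\<in>C. \<Sum>y\<in>C - {x}. \<Prod>i<n. 1 + (x i \<bullet> y i)\<^sup>2) \<le> 2 * 3 ^ n"
proof -
  define I where "I = (SIGMA x:C. C - {x})"
  define A where "A p i = orth_proj (fst p i) ** orth_proj (snd p i)" for p :: "(nat \<Rightarrow> real^3) \<times> (nat \<Rightarrow> real^3)" and i :: nat
  define T where "T = (\<Sum>p\<in>I. \<Prod>i<n. trace (A p i))"
  have norm: "norm (x i) = 1" if "x \<in> C" "i < n" for x i
    using C that by (auto simp: vector_trifferent_code_def sphere_words_def)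
  have tri: "\<exists>i<n. orth_proj (x i) ** orth_proj (y i) ** orth_proj (z i) = 0"
    if "x \<in> C" "y \<in> C" "z \<in> C" "x \<noteq> y" "y \<noteq> z" "x \<noteq> z" for x y z
  proof -
    have "vector_trifferent n x y z"
      using C that by (auto simp: vector_trifferent_code_def)
    then show ?thesis
      using norm that by (auto simp: vector_trifferent_def intro!: orth_proj_mult3_eq_0)
  qed
  have tr: "trace (A p i) = 1 + (fst p i \<bullet> snd p i)\<^sup>2" if "p \<in> I" "i < n" for p i
    using that by (auto simp: A_def I_def trace_orth_proj_mult norm)
  have T: "T = (\<Sum>x\<in>C. \<Sum>y\<in>C - {x}. \<Prod>i<n. 1 + (x i \<bullet> y i)\<^sup>2)"
  proof -
    have "T = (\<Sum>p\<in>I. \<Prod>i<n. 1 + (fst p i \<bullet> snd p i)\<^sup>2)"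
      unfolding T_def by (intro sum.cong prod.cong) (auto simp: tr)
    then show ?thesis
      unfolding I_def using fin by (simp add: sum.Sigma case_prod_unfold)
  qed
  have vanish: "(\<Prod>i<n. trace (A p i ** transpose (A q i))) = 0"
    if p: "p \<in> I" and q: "q \<in> I - {p, prod.swap p}" for p q
  proof -
    obtain x y z t where pq: "p = (x, y)" "q = (z, t)" by fastforce
    have mem: "x \<in> C" "y \<in> C" "z \<in> C" "t \<in> C" "x \<noteq> y" "z \<noteq> t" "\<not> (z = x \<and> t = y)" "\<not> (z = y \<and> t = x)"
      using p q by (auto simp: pq I_def)
    have E: "A p i ** transpose (A q i) = orth_proj (x i) ** orth_proj (y i) ** (orth_proj (t i) ** orth_proj (z i))" for i
      by (simp add: A_def pq matrix_transpose_mul)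
    have "\<exists>i<n. A p i ** transpose (A q i) = 0"
    proof -
      \<comment> \<open>The four projections stand in the order \<open>x\<close>, \<open>y\<close>,
        \<open>t\<close>, \<open>z\<close>. Either the first three belong to distinct words; or
        \<open>t = y\<close>, the equal neighbours merge and \<open>x\<close>, \<open>y\<close>,
        \<open>z\<close> are distinct; or \<open>t = x\<close> and the last three are
        distinct.\<close>
      consider "t \<noteq> x" "t \<noteq> y" | "t = y" | "t = x" by blast
      then show ?thesis
      proof cases
        case 1
        then obtain i where "i < n" "orth_proj (x i) ** orth_proj (y i) ** orth_proj (t i) = 0"
          using tri[of x y t] mem by blast
        then show ?thesis
          by (intro exI[of _ i]) (simp add: E matrix_mul_assoc)
      next
        case 2
        then obtain i where i: "i < n" "orth_proj (x i) ** orth_proj (y i) ** orth_proj (z i) = 0"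
          using tri[of x y z] mem by blast
        have "A p i ** transpose (A q i) = orth_proj (x i) ** (orth_proj (y i) ** orth_proj (y i)) ** orth_proj (z i)"
          by (simp add: E 2 matrix_mul_assoc)
        with i show ?thesis
          using norm mem by (intro exI[of _ i]) (simp add: orth_proj_idem)
      next
        case 3
        then obtain i where i: "i < n" "orth_proj (y i) ** orth_proj (x i) ** orth_proj (z i) = 0"
          using tri[of y x z] mem by metis
        have "A p i ** transpose (A q i) = orth_proj (x i) ** (orth_proj (y i) ** orth_proj (x i) ** orth_proj (z i))"
          by (simp add: E 3 matrix_mul_assoc)
        with i show ?thesis
          by (intro exI[of _ i]) simp
      qed
    qed
    then obtain i where "i < n" "A p i ** transpose (A q i) = 0" by blast
    then show ?thesis
      by (intro prod_zero bexI[of _ i]) (auto simp: trace_def)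
  qed
  have row: "(\<Sum>q\<in>I. \<Prod>i<n. trace (A p i ** transpose (A q i))) \<le> 2 * (\<Prod>i<n. trace (A p i))"
    if p: "p \<in> I" for p
  proof -
    obtain x y where xy: "p = (x, y)" by fastforce
    have mem: "x \<in> C" "y \<in> C" "x \<noteq> y" using p by (auto simp: xy I_def)
    \<comment> \<open>Idempotence reduces the product to the projections of \<open>x\<close>,
      \<open>y\<close>, \<open>x\<close>; moving the last one to the front cyclically merges it with
      the first.\<close>
    have same: "trace (A p i ** transpose (A p i)) = trace (A p i)" if "i < n" for i
    proof -
      have "A p i ** transpose (A p i) = orth_proj (x i) ** (orth_proj (y i) ** orth_proj (y i)) ** orth_proj (x i)"
        by (simp add: A_def xy matrix_transpose_mul matrix_mul_assoc)
      also have "\<dots> = orth_proj (x i) ** orth_proj (y i) ** orth_proj (x i)"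
        using norm mem that by (simp add: orth_proj_idem)
      finally have "trace (A p i ** transpose (A p i)) = trace (orth_proj (x i) ** (orth_proj (x i) ** orth_proj (y i)))"
        by (simp add: trace_mul_sym[of _ "orth_proj (x i)"])
      also have "\<dots> = trace (A p i)"
        using norm mem that by (simp add: orth_proj_idem matrix_mul_assoc A_def xy)
      finally show ?thesis .
    qed
    have swapped: "A p i ** transpose (A (prod.swap p) i) = A p i ** A p i" for i
      by (simp add: A_def xy matrix_transpose_mul)
    have "(\<Prod>i<n. trace (A p i ** transpose (A (prod.swap p) i))) \<le> \<bar>\<Prod>i<n. trace (A p i ** A p i)\<bar>"
      by (simp add: swapped)
    also have "\<dots> \<le> (\<Prod>i<n. trace (A p i))"
      unfolding abs_prod using abs_trace_square_le[of "A p _"] by (intro prod_mono) (auto simp flip: same)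
    finally have sw: "(\<Prod>i<n. trace (A p i ** transpose (A (prod.swap p) i))) \<le> (\<Prod>i<n. trace (A p i))" .
    have "(\<Sum>q\<in>I. \<Prod>i<n. trace (A p i ** transpose (A q i)))
        = (\<Sum>q\<in>{p, prod.swap p}. \<Prod>i<n. trace (A p i ** transpose (A q i)))"
      using fin mem vanish[OF p] by (intro sum.mono_neutral_right) (auto simp: I_def xy)
    also have "\<dots> = (\<Prod>i<n. trace (A p i ** transpose (A p i))) + (\<Prod>i<n. trace (A p i ** transpose (A (prod.swap p) i)))"
      using mem by (simp add: xy)
    also have "\<dots> \<le> 2 * (\<Prod>i<n. trace (A p i))"
      using sw by (simp add: same)
    finally show ?thesis .
  qed
  have "T\<^sup>2 \<le> real CARD(3) ^ n * (\<Sum>p\<in>I. \<Sum>q\<in>I. \<Prod>i<n. trace (A p i ** transpose (A q i)))"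
    unfolding T_def by (rule tensor_trace_square_le)
  also have "\<dots> \<le> real CARD(3) ^ n * (\<Sum>p\<in>I. 2 * (\<Prod>i<n. trace (A p i)))"
    by (intro mult_left_mono sum_mono row) auto
  also have "\<dots> = (2 * 3 ^ n) * T"
    by (simp add: T_def sum_distrib_left mult_ac)
  finally have "T * T \<le> (2 * 3 ^ n) * T" by (simp add: power2_eq_square)
  moreover have "0 \<le> T"
    unfolding T by (intro sum_nonneg prod_nonneg) auto
  ultimately have "T \<le> 2 * 3 ^ n"
    by (cases "T = 0") (auto simp: mult_le_cancel_right)
  then show ?thesis by (simp add: T)
qed

section \<open>Lower bound from the weighted subset expansion\<close>

text \<open>Both products are expanded over subsets \<open>S\<close>; each factor \<open>k\<close>
  in the second carries one phase, so \<open>S\<close> gets the real part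
  \<open>cos (card S * \<phi>)\<close>. All weights \<open>a S\<close> and kernel sums
  \<open>G S\<close> are nonnegative, and only \<open>S = {}\<close> is kept. The sum is not halved,
  so the weight there is \<open>2 * (4/3) ^ n\<close>.\<close>

lemma card_sq_le_tilted_sum:
  fixes \<phi> :: real
  assumes C: "C \<subseteq> sphere_words n" and fin: "finite C"
  defines "k \<equiv> \<lambda>x y i. ((x :: nat \<Rightarrow> real^3) i \<bullet> y i)\<^sup>2 - 1/3"
  shows "2 * (real (card C))\<^sup>2 * (4/3) ^ n
    \<le> (\<Sum>x\<in>C. \<Sum>y\<in>C. (\<Prod>i<n. 4/3 + k x y i) + Re (\<Prod>i<n. 4/3 + cis \<phi> * complex_of_real (k x y i)))"
proof -
  define a where "a S = (1 + cos (real (card S) * \<phi>)) * (4/3) ^ (n - card S)" for S :: "nat set"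
  define G where "G S = (\<Sum>x\<in>C. \<Sum>y\<in>C. \<Prod>i\<in>S. k x y i)" for S
  have expand: "(\<Prod>i<n. 4/3 + k x y i) + Re (\<Prod>i<n. 4/3 + cis \<phi> * complex_of_real (k x y i))
      = (\<Sum>S\<in>Pow {..<n}. a S * (\<Prod>i\<in>S. k x y i))" for x y
  proof -
    have 1: "(\<Prod>i<n. 4/3 + k x y i) = (\<Sum>S\<in>Pow {..<n}. (4/3) ^ (n - card S) * (\<Prod>i\<in>S. k x y i))"
    proof -
      have "(\<Prod>i<n. k x y i + 4/3) = (\<Sum>S\<in>Pow {..<n}. (4/3) ^ (n - card S) * (\<Prod>i\<in>S. k x y i))"
        by (subst prod_add) (auto intro!: sum.cong simp: card_Diff_subset finite_subset mult.commute)
      then show ?thesis by (simp add: add.commute)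
    qed
    have 2: "(\<Prod>i<n. 4/3 + cis \<phi> * complex_of_real (k x y i))
        = (\<Sum>S\<in>Pow {..<n}. cis (real (card S) * \<phi>) * complex_of_real ((4/3) ^ (n - card S) * (\<Prod>i\<in>S. k x y i)))"
    proof -
      have "(\<Prod>i<n. cis \<phi> * complex_of_real (k x y i) + 4/3)
        = (\<Sum>S\<in>Pow {..<n}. cis (real (card S) * \<phi>) * complex_of_real ((4/3) ^ (n - card S) * (\<Prod>i\<in>S. k x y i)))"
        by (subst prod_add)
          (auto intro!: sum.cong simp: card_Diff_subset finite_subset prod.distrib Complex.DeMoivre mult_ac)
      then show ?thesis by (simp add: add.commute)
    qed
    show ?thesis
      unfolding 1 2 Re_sum sum.distrib[symmetric]
      by (intro sum.cong) (auto simp: a_def algebra_simps simp flip: of_real_prod)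
  qed
  have "(\<Sum>x\<in>C. \<Sum>y\<in>C. (\<Prod>i<n. 4/3 + k x y i) + Re (\<Prod>i<n. 4/3 + cis \<phi> * complex_of_real (k x y i)))
      = (\<Sum>x\<in>C. \<Sum>S\<in>Pow {..<n}. \<Sum>y\<in>C. a S * (\<Prod>i\<in>S. k x y i))"
    unfolding expand by (intro sum.cong refl sum.swap)
  also have "\<dots> = (\<Sum>S\<in>Pow {..<n}. a S * G S)"
    by (subst sum.swap) (simp add: G_def sum_distrib_left)
  also have "\<dots> \<ge> (\<Sum>S\<in>{{}}. a S * G S)"
  proof (intro sum_mono2)
    fix S assume S: "S \<in> Pow {..<n} - {{}}"
    have norm: "norm (x i) = 1" if "x \<in> C" "i \<in> S" for x i
      using C S that by (auto simp: sphere_words_def)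
    have "G S = (\<Sum>x\<in>C. \<Sum>y\<in>C. \<Prod>i\<in>S. \<Sum>p\<in>UNIV.
        (case p of (a, b) \<Rightarrow> x i $ a * x i $ b - (if a = b then 1/3 else 0)) *
        (case p of (a, b) \<Rightarrow> y i $ a * y i $ b - (if a = b then 1/3 else 0)))"
      unfolding G_def k_def
      by (intro sum.cong prod.cong refl)
        (simp add: inner_sq_minus_third_eq_gram norm case_prod_unfold)
    also have "\<dots> \<ge> 0"
      using S by (intro gram_prod_sum_nonneg) (auto intro: finite_subset)
    finally have "G S \<ge> 0" .
    moreover have "a S \<ge> 0"
    proof -
      have "0 \<le> 1 + cos (real (card S) * \<phi>)"
        using cos_ge_minus_one[of "real (card S) * \<phi>"] by linarith
      then show ?thesis by (simp only: a_def) simp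
    qed
    ultimately show "0 \<le> a S * G S" by simp
  qed auto
  finally show ?thesis
    by (simp add: a_def G_def power2_eq_square mult_ac)
qed


section \<open>Estimates for the tilted factors\<close>

text \<open>Tilting changes the squared modulus by \<open>- 8/3 * k * (1 - cos \<phi>)\<close>,
  which is positive only for negative \<open>k\<close>. With \<open>k \<ge> -1/3\<close> the gain is
  at most \<open>\<phi>\<^sup>2\<close>, and it is absorbed multiplicatively because
  \<open>4/3 + k \<ge> 1\<close>.\<close>

lemma cmod_tilt_le:
  fixes k \<phi> :: real
  assumes "k \<ge> -1/3"
  shows "cmod (4/3 + cis \<phi> * complex_of_real k) \<le> (4/3 + k) * (1 + \<phi>\<^sup>2)"
proof (rule power2_le_imp_le)
  have cos: "0 \<le> 1 - cos \<phi>" "1 - cos \<phi> \<le> \<phi>\<^sup>2"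
  proof -
    have "1 - cos \<phi> = 2 * (sin (\<phi>/2))\<^sup>2"
      using cos_double_sin[of "\<phi>/2"] by simp
    also have "\<dots> \<le> 2 * (\<phi>/2)\<^sup>2"
      using abs_sin_x_le_abs_x[of "\<phi>/2"] unfolding abs_le_square_iff by simp
    also have "\<dots> \<le> \<phi>\<^sup>2" by (simp add: power2_eq_square)
    finally show "1 - cos \<phi> \<le> \<phi>\<^sup>2" .
  qed simp
  have "(cmod (4/3 + cis \<phi> * complex_of_real k))\<^sup>2 = (4/3 + k * cos \<phi>)\<^sup>2 + (k * sin \<phi>)\<^sup>2"
    by (simp add: cmod_power2 mult.commute)
  also have "\<dots> = (4/3 + k)\<^sup>2 - 8/3 * k * (1 - cos \<phi>)"
  proof -
    have "(sin \<phi>)\<^sup>2 = 1 - (cos \<phi>)\<^sup>2" by (simp add: sin_squared_eq)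
    then have "k\<^sup>2 * (sin \<phi>)\<^sup>2 = k\<^sup>2 - k\<^sup>2 * (cos \<phi>)\<^sup>2" by (simp add: right_diff_distrib)
    then show ?thesis by (simp add: power_mult_distrib power2_sum field_simps)
  qed
  also have "\<dots> \<le> (4/3 + k)\<^sup>2 + 8/9 * (1 - cos \<phi>)"
  proof -
    have "- (8/9 * d) \<le> 8/3 * k * d" if "d \<ge> 0" for d
      using mult_right_mono[OF assms that] by simp
    from this[OF cos(1)] show ?thesis by linarith
  qed
  also have "\<dots> \<le> (4/3 + k)\<^sup>2 + \<phi>\<^sup>2"
  proof -
    have "8/9 * d \<le> e" if "0 \<le> d" "d \<le> e" for d e :: real
      using that by linarith
    from this[OF cos] show ?thesis by simp
  qed
  also have "\<dots> \<le> (4/3 + k)\<^sup>2 * (1 + \<phi>\<^sup>2)"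
  proof -
    have "1\<^sup>2 \<le> (4/3 + k)\<^sup>2" using assms by (intro power_mono) auto
    then have "1 * \<phi>\<^sup>2 \<le> (4/3 + k)\<^sup>2 * \<phi>\<^sup>2" by (intro mult_right_mono) auto
    then show ?thesis by (simp add: algebra_simps)
  qed
  \<comment> \<open>Squaring the last factor makes the bound a perfect square, ready for taking
    roots.\<close>
  also have "\<dots> \<le> (4/3 + k)\<^sup>2 * (1 + \<phi>\<^sup>2)\<^sup>2"
    by (intro mult_left_mono self_le_power) auto
  finally show "(cmod (4/3 + cis \<phi> * complex_of_real k))\<^sup>2 \<le> ((4/3 + k) * (1 + \<phi>\<^sup>2))\<^sup>2"
    by (simp add: power_mult_distrib)
qed (use assms in auto)

text \<open>This is \<open>n\<close> times the sum of the absolute real and imaginary parts of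
  \<open>2/3 + cis (3 * pi / n) / 3 - cis (pi / n)\<close>. The constant and first-order terms in
  \<open>1 / n\<close> cancel in that difference, which is why the factor \<open>n\<close> is
  harmless.\<close>

definition phase_err :: "nat \<Rightarrow> real" where
  "phase_err n = real n * (\<bar>2/3 + cos (3 * pi / real n) / 3 - cos (pi / real n)\<bar>
    + \<bar>sin (3 * pi / real n) / 3 - sin (pi / real n)\<bar>)"

lemma phase_err_tendsto_0: "phase_err \<longlonglongrightarrow> 0"
  unfolding phase_err_def by real_asymp

lemma one_plus_square_power_tendsto_1:
  fixes a :: real
  shows "(\<lambda>n. (1 + (a / real n)\<^sup>2) ^ n) \<longlonglongrightarrow> 1"
proof (rule tendsto_sandwich[where f = "\<lambda>_. 1"])
  show "\<forall>\<^sub>F n in sequentially. (1 + (a / real n)\<^sup>2) ^ n \<le> exp (a\<^sup>2 / real n)"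
  proof (intro always_eventually allI)
    fix n
    have "(1 + (a / real n)\<^sup>2) ^ n \<le> exp ((a / real n)\<^sup>2) ^ n"
      by (intro power_mono exp_ge_add_one_self) simp
    also have "\<dots> = exp (a\<^sup>2 / real n)"
      by (simp add: power2_eq_square flip: exp_of_nat_mult)
    finally show "(1 + (a / real n)\<^sup>2) ^ n \<le> exp (a\<^sup>2 / real n)" .
  qed
  show "(\<lambda>n. exp (a\<^sup>2 / real n)) \<longlonglongrightarrow> 1"
    by real_asymp
qed (auto intro!: always_eventually one_le_power)

text \<open>On the closed unit disc the \<open>n\<close>-th power is Lipschitz with constant
  \<open>n\<close>. The base is compared with \<open>cis (pi / n)\<close>, whose \<open>n\<close>-th
  power is \<open>-1\<close>.\<close>

lemma one_plus_Re_tilt_power_le: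
  assumes "n > 0"
  shows "1 + Re ((2/3 + cis (3 * pi / real n) / 3) ^ n) \<le> phase_err n"
proof -
  define w where "w = 2/3 + cis (3 * pi / real n) / 3"
  have "cmod w \<le> cmod (2/3) + cmod (cis (3 * pi / real n) / 3)"
    unfolding w_def by (rule norm_triangle_ineq)
  then have w: "cmod w \<le> 1" by (simp add: norm_divide)
  have m1: "cis (pi / real n) ^ n = -1"
    using assms by (simp add: Complex.DeMoivre)
  have "1 + Re (w ^ n) = Re (w ^ n - cis (pi / real n) ^ n)"
    by (simp add: m1)
  also have "\<dots> \<le> cmod (w ^ n - cis (pi / real n) ^ n)"
    by (rule complex_Re_le_cmod)
  also have "\<dots> \<le> real n * cmod (w - cis (pi / real n))"
    using w by (intro norm_power_diff) auto
  also have "\<dots> \<le> real n * (\<bar>Re (w - cis (pi / real n))\<bar> + \<bar>Im (w - cis (pi / real n))\<bar>)"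
    by (intro mult_left_mono cmod_le) auto
  also have "\<dots> = phase_err n"
    by (simp add: phase_err_def w_def)
  finally show ?thesis by (simp add: w_def)
qed

section \<open>The quadratic inequality and its asymptotic consequence\<close>

lemma code_card_quadratic:
  assumes C: "vector_trifferent_code n C" and fin: "finite C" and n: "n > 0"
  defines "m \<equiv> real (card C) * (2/3) ^ n"
  shows "2 * m\<^sup>2 \<le> m * phase_err n + 2 * (1 + (1 + (3 * pi / real n)\<^sup>2) ^ n)"
proof -
  define \<phi> where "\<phi> = 3 * pi / real n"
  define k where "k x y i = ((x :: nat \<Rightarrow> real^3) i \<bullet> y i)\<^sup>2 - 1/3" for x y and i :: nat
  define L where "L x y = (\<Prod>i<n. 4/3 + k x y i) + Re (\<Prod>i<n. 4/3 + cis \<phi> * complex_of_real (k x y i))" for x y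
  define E where "E = (1 + \<phi>\<^sup>2) ^ n"
  have sub: "C \<subseteq> sphere_words n" using C by (simp add: vector_trifferent_code_def)
  have k_ge: "-1/3 \<le> k x y i" for x y i by (simp add: k_def)
  \<comment> \<open>For equal unit vectors \<open>k\<close> is \<open>2/3\<close>, so the plain
    factor is \<open>2\<close> and the tilted one \<open>2 * (2/3 + cis \<phi> / 3)\<close>: the two
    powers nearly cancel.\<close>
  have diag: "L x x \<le> 2 ^ n * phase_err n" if "x \<in> C" for x
  proof -
    have k: "k x x i = 2/3" if "i < n" for i
      using sub \<open>x \<in> C\<close> that by (auto simp: k_def sphere_words_def norm_eq_1)
    have "L x x = (\<Prod>i<n. 2) + Re (\<Prod>i<n. 4/3 + cis \<phi> * complex_of_real (2/3))"
      unfolding L_def by (intro arg_cong2[where f = "(+)"] arg_cong[where f = Re] prod.cong) (auto simp: k)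
    also have "\<dots> = 2 ^ n + Re ((complex_of_real 2 * (2/3 + cis \<phi> / 3)) ^ n)"
      by (simp add: algebra_simps)
    also have "\<dots> = 2 ^ n * (1 + Re ((2/3 + cis \<phi> / 3) ^ n))"
      unfolding power_mult_distrib of_real_power[symmetric] by (simp add: algebra_simps del: of_real_power)
    also have "\<dots> \<le> 2 ^ n * phase_err n"
      using one_plus_Re_tilt_power_le[OF n] by (intro mult_left_mono) (auto simp: \<phi>_def)
    finally show ?thesis .
  qed
  \<comment> \<open>Here \<open>4/3 + k x y i\<close> is the overlap factor
    \<open>1 + (x i \<bullet> y i)\<^sup>2\<close>, and \<open>E\<close> collects the tilting losses
    of all coordinates.\<close>
  have off: "L x y \<le> (1 + E) * (\<Prod>i<n. 1 + (x i \<bullet> y i)\<^sup>2)" for x y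
  proof -
    have "Re (\<Prod>i<n. 4/3 + cis \<phi> * complex_of_real (k x y i)) \<le> (\<Prod>i<n. cmod (4/3 + cis \<phi> * complex_of_real (k x y i)))"
      by (metis complex_Re_le_cmod prod_norm)
    also have "\<dots> \<le> (\<Prod>i<n. (4/3 + k x y i) * (1 + \<phi>\<^sup>2))"
      using cmod_tilt_le[OF k_ge] by (intro prod_mono) auto
    also have "\<dots> = E * (\<Prod>i<n. 4/3 + k x y i)"
      by (simp add: prod.distrib E_def)
    finally show ?thesis
      by (simp add: L_def k_def algebra_simps)
  qed
  have "2 * (real (card C))\<^sup>2 * (4/3) ^ n \<le> (\<Sum>x\<in>C. \<Sum>y\<in>C. L x y)"
    using card_sq_le_tilted_sum[OF sub fin, of \<phi>] by (simp only: L_def k_def)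
  also have "\<dots> = (\<Sum>x\<in>C. L x x + (\<Sum>y\<in>C - {x}. L x y))"
    using fin by (intro sum.cong refl sum.remove)
  also have "\<dots> \<le> (\<Sum>x\<in>C. 2 ^ n * phase_err n + (\<Sum>y\<in>C - {x}. (1 + E) * (\<Prod>i<n. 1 + (x i \<bullet> y i)\<^sup>2)))"
    by (intro sum_mono add_mono diag off)
  also have "\<dots> = real (card C) * 2 ^ n * phase_err n + (1 + E) * (\<Sum>x\<in>C. \<Sum>y\<in>C - {x}. \<Prod>i<n. 1 + (x i \<bullet> y i)\<^sup>2)"
    by (simp add: sum.distrib sum_distrib_left mult_ac)
  also have "\<dots> \<le> real (card C) * 2 ^ n * phase_err n + (1 + E) * (2 * 3 ^ n)"
    by (intro add_left_mono mult_left_mono sum_cross_overlap_le[OF C fin]) (auto simp: E_def)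
  \<comment> \<open>Dividing by \<open>3 ^ n\<close> makes everything a polynomial in
    \<open>m\<close>, since \<open>4/9\<close> is the square of \<open>2/3\<close>.\<close>
  finally have "2 * (real (card C))\<^sup>2 * (4/3) ^ n / 3 ^ n
      \<le> (real (card C) * 2 ^ n * phase_err n + (1 + E) * (2 * 3 ^ n)) / 3 ^ n"
    by (intro divide_right_mono) auto
  moreover have "2 * (real (card C))\<^sup>2 * (4/3) ^ n / 3 ^ n = 2 * m\<^sup>2"
  proof -
    have "(4/3) ^ n / 3 ^ n = ((2/3) ^ n :: real)\<^sup>2"
      unfolding power2_eq_square power_divide[of "4/3", symmetric] power_mult_distrib[symmetric] by simp
    then have "2 * (real (card C))\<^sup>2 * ((4/3) ^ n / 3 ^ n) = 2 * m\<^sup>2"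
      by (simp only: m_def power_mult_distrib mult.assoc)
    then show ?thesis by (simp only: times_divide_eq_right)
  qed
  moreover have "(real (card C) * 2 ^ n * phase_err n + (1 + E) * (2 * 3 ^ n)) / 3 ^ n = m * phase_err n + 2 * (1 + E)"
    by (simp add: m_def power_divide add_divide_distrib)
  ultimately show ?thesis by (simp add: E_def \<phi>_def)
qed

lemma vector_trifferent_code_subset:
  assumes "vector_trifferent_code n C" "B \<subseteq> C"
  shows "vector_trifferent_code n B"
  using assms by (simp add: vector_trifferent_code_def subset_iff)

theorem theorem1:
  fixes \<epsilon> :: real
  assumes "\<epsilon> > 0"
  shows "\<exists>N::nat. \<forall>n\<ge>N. \<forall>C. vector_trifferent_code n C \<longrightarrow>
           finite C \<and> real (card C) \<le> (sqrt 2 + \<epsilon>) * (3/2) ^ n"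
proof -
  define s where "s = sqrt 2 + \<epsilon>"
  \<comment> \<open>A positive \<open>gap n\<close> says that \<open>s\<close> in place of
    \<open>m\<close> violates the quadratic inequality; the limit is
    \<open>2 * s\<^sup>2 - 4 > 0\<close>.\<close>
  define gap where "gap n = s * (2 * s - phase_err n) - 2 * (1 + (1 + (3 * pi / real n)\<^sup>2) ^ n)" for n
  have s: "s > 0" using assms by (simp add: s_def add_pos_pos)
  have "(sqrt 2)\<^sup>2 < s\<^sup>2"
    using assms by (intro power_strict_mono) (auto simp: s_def)
  then have s2: "s\<^sup>2 > 2" by simp
  have "gap \<longlonglongrightarrow> s * (2 * s - 0) - 2 * (1 + 1)"
    unfolding gap_def by (intro tendsto_intros phase_err_tendsto_0 one_plus_square_power_tendsto_1)
  moreover have "s * (2 * s - 0) - 2 * (1 + 1) > 0"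
    using s2 by (simp add: power2_eq_square)
  ultimately have "\<forall>\<^sub>F n in sequentially. gap n > 0"
    by (rule order_tendstoD)
  moreover have "\<forall>\<^sub>F n in sequentially. phase_err n < 2 * s"
    using s by (intro order_tendstoD[OF phase_err_tendsto_0]) auto
  ultimately have "\<forall>\<^sub>F n in sequentially. n > 0 \<and> gap n > 0 \<and> phase_err n < 2 * s"
    using eventually_gt_at_top[of 0] by eventually_elim auto
  then obtain N where N: "\<And>n. n \<ge> N \<Longrightarrow> n > 0 \<and> gap n > 0 \<and> phase_err n < 2 * s"
    by (auto simp: eventually_sequentially)
  have bound: "real (card C) \<le> s * (3/2) ^ n"
    if n: "n \<ge> N" and C: "vector_trifferent_code n C" "finite C" for n C
  proof (rule ccontr)
    define m where "m = real (card C) * (2/3) ^ n"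
    assume "\<not> real (card C) \<le> s * (3/2) ^ n"
    then have "s * (3/2) ^ n * (2/3) ^ n < m"
      by (simp add: m_def)
    moreover have "(3/2) ^ n * (2/3) ^ n = (1 :: real)"
      unfolding power_mult_distrib[symmetric] by simp
    ultimately have "m > s"
      by (simp add: mult.assoc)
    \<comment> \<open>The condition \<open>phase_err n < 2 * s\<close> keeps the second factor
      nonnegative, so the violation at \<open>s\<close> persists for every larger
      \<open>m\<close>.\<close>
    then have "s * (2 * s - phase_err n) \<le> m * (2 * m - phase_err n)"
      using s N[OF n] by (intro mult_mono) auto
    also have "\<dots> \<le> 2 * (1 + (1 + (3 * pi / real n)\<^sup>2) ^ n)"
      using code_card_quadratic[OF C] N[OF n] by (simp add: m_def power2_eq_square algebra_simps)
    finally show False using N[OF n] by (simp add: gap_def)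
  qed
  have "finite C \<and> real (card C) \<le> s * (3/2) ^ n"
    if n: "n \<ge> N" and C: "vector_trifferent_code n C" for n C
  proof -
    \<comment> \<open>As \<open>card\<close> is 0 on infinite sets, finiteness needs its own
      argument: an infinite code would contain a finite subcode exceeding the bound.\<close>
    have "finite C"
    proof (rule ccontr)
      assume "infinite C"
      then obtain B where B: "finite B" "card B = nat \<lceil>s * (3/2) ^ n\<rceil> + 1" "B \<subseteq> C"
        using infinite_arbitrarily_large by blast
      then have "real (card B) \<le> s * (3/2) ^ n"
        using bound[OF n vector_trifferent_code_subset[OF C]] by blast
      then show False using B(2) by linarith
    qed
    then show ?thesis using bound[OF n C] by blast
  qed
  then show ?thesis unfolding s_def by blast
qed

end
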